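(* The quotient space $\Omega=\mathcal{V}/\!\leftrightarrow$, with the addition $\bar{x}\,\vec{+}\,\bar{y}:=\overline{x\,\vec{+}\,y}$ and the scalar product $a\cdot\bar{x}:=\overline{ax}$ ($a\in\mathbb{R}$), is a real vector space.
   Context: $\mathcal{V}=\bigcup_{n\ge1}\mathcal{V}_n$ (disjoint union), where $\mathcal{V}_n=\mathbb{R}^n$ (column vectors); $\otimes$ is the Kronecker product and $\mathbf{1}_k\in\mathbb{R}^k$ is the all-ones column. V-addition (written $\vec{+}$ here): for $x\in\mathcal{V}_m$, $y\in\mathcal{V}_n$, $t=\operatorname{lcm}(m,n)$: $x\,\vec{+}\,y:=(x\otimes\mathbf{1}_{t/m})+(y\otimes\mathbf{1}_{t/n})$. V-equivalence: $x\leftrightarrow y$ if there exist $\alpha,\beta\in\mathbb{N}=\{1,2,\dots\}$ with $x\otimes\mathbf{1}_\alpha=y\otimes\mathbf{1}_\beta$. This is an equivalence relation; $\bar{x}$ denotes the class of $x$, and the operations in the claim do not depend on the choice of representatives. *)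

theory Defs
  imports "Jordan_Normal_Form.VS_Connect"
begin

definition V_space :: "real vec set" where
  "V_space = (\<Union>n\<in>{1..}. carrier_vec n)"

definition ones_vec :: "nat \<Rightarrow> real vec" where
  "ones_vec k = vec k (\<lambda>_. 1)"

text \<open>Kronecker product of column vectors: entry \<open>i * dim_vec y + j\<close> is \<open>x $ i * y $ j\<close>.\<close>

definition kron_vec :: "real vec \<Rightarrow> real vec \<Rightarrow> real vec" (infixl \<open>\<otimes>\<^sub>v\<close> 75) where
  "x \<otimes>\<^sub>v y = vec (dim_vec x * dim_vec y) (\<lambda>i. x $ (i div dim_vec y) * y $ (i mod dim_vec y))"

definition V_add :: "real vec \<Rightarrow> real vec \<Rightarrow> real vec" where
  "V_add x y = (let t = lcm (dim_vec x) (dim_vec y) in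
     x \<otimes>\<^sub>v ones_vec (t div dim_vec x) + y \<otimes>\<^sub>v ones_vec (t div dim_vec y))"

definition V_equiv :: "real vec rel" where
  "V_equiv = {(x, y). x \<in> V_space \<and> y \<in> V_space \<and>
     (\<exists>\<alpha>\<ge>1. \<exists>\<beta>\<ge>1. x \<otimes>\<^sub>v ones_vec \<alpha> = y \<otimes>\<^sub>v ones_vec \<beta>)}"

definition V_class :: "real vec \<Rightarrow> real vec set" where
  "V_class x = V_equiv `` {x}"

text \<open>
  The operations on classes follow the pattern of \<open>UN_equiv_class\<close>: the union over all
  representatives is the class of any one result, because the operations respect \<open>V_equiv\<close>
  (see \<open>Omega_add_class\<close> and \<open>Omega_smult_class\<close> below).
\<close>

definition Omega_add :: "real vec set \<Rightarrow> real vec set \<Rightarrow> real vec set" where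
  "Omega_add X Y = (\<Union>x\<in>X. \<Union>y\<in>Y. V_class (V_add x y))"

definition Omega_smult :: "real \<Rightarrow> real vec set \<Rightarrow> real vec set" where
  "Omega_smult a X = (\<Union>x\<in>X. V_class (a \<cdot>\<^sub>v x))"

text \<open>The fields \<open>mult\<close> and \<open>one\<close> of the record play no role for a module.\<close>

definition Omega :: "(real, real vec set) module" where
  "Omega = \<lparr>
     carrier = V_space // V_equiv,
     mult = undefined,
     one = undefined,
     zero = V_class (0\<^sub>v 1),
     add = Omega_add,
     smult = Omega_smult\<rparr>"


lemma V_space_iff: "x \<in> V_space \<longleftrightarrow> dim_vec x \<ge> 1"
  unfolding V_space_def carrier_vec_def by blast

lemma dim_kron_ones [simp]: "dim_vec (x \<otimes>\<^sub>v ones_vec k) = dim_vec x * k"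
  by (simp add: kron_vec_def ones_vec_def)

lemma index_kron_ones:
  assumes "i < dim_vec x * k"
  shows "(x \<otimes>\<^sub>v ones_vec k) $ i = x $ (i div k)"
proof -
  have "k > 0" using assms by (cases k) auto
  then show ?thesis using assms by (simp add: kron_vec_def ones_vec_def)
qed

lemma kron_ones_kron_ones: "x \<otimes>\<^sub>v ones_vec a \<otimes>\<^sub>v ones_vec b = x \<otimes>\<^sub>v ones_vec (a * b)"
proof (rule eq_vecI)
  fix i assume "i < dim_vec (x \<otimes>\<^sub>v ones_vec (a * b))"
  then have i: "i < dim_vec x * a * b" by (simp add: mult.assoc)
  then have "i div b < dim_vec x * a"
    by (simp add: less_mult_imp_div_less)
  then show "(x \<otimes>\<^sub>v ones_vec a \<otimes>\<^sub>v ones_vec b) $ i = (x \<otimes>\<^sub>v ones_vec (a * b)) $ i"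
    using i by (simp add: index_kron_ones mult.assoc div_mult2_eq[symmetric] mult.commute[of b a])
qed (simp add: mult.assoc)

lemma kron_ones_add:
  assumes "dim_vec x = dim_vec y"
  shows "(x + y) \<otimes>\<^sub>v ones_vec k = x \<otimes>\<^sub>v ones_vec k + y \<otimes>\<^sub>v ones_vec k"
proof (rule eq_vecI)
  fix i assume "i < dim_vec (x \<otimes>\<^sub>v ones_vec k + y \<otimes>\<^sub>v ones_vec k)"
  then have i: "i < dim_vec y * k" by simp
  then have "i div k < dim_vec y" by (simp add: less_mult_imp_div_less)
  then show "((x + y) \<otimes>\<^sub>v ones_vec k) $ i = (x \<otimes>\<^sub>v ones_vec k + y \<otimes>\<^sub>v ones_vec k) $ i"
    using i assms by (simp add: index_kron_ones)
qed simp

lemma kron_ones_smult: "(a \<cdot>\<^sub>v x) \<otimes>\<^sub>v ones_vec k = a \<cdot>\<^sub>v (x \<otimes>\<^sub>v ones_vec k)"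
proof (rule eq_vecI)
  fix i assume "i < dim_vec (a \<cdot>\<^sub>v (x \<otimes>\<^sub>v ones_vec k))"
  then have i: "i < dim_vec x * k" by simp
  then have "i div k < dim_vec x" by (simp add: less_mult_imp_div_less)
  then show "((a \<cdot>\<^sub>v x) \<otimes>\<^sub>v ones_vec k) $ i = (a \<cdot>\<^sub>v (x \<otimes>\<^sub>v ones_vec k)) $ i"
    using i by (simp add: index_kron_ones)
qed simp

lemma equiv_V_equiv: "equiv V_space V_equiv"
proof (rule equivI)
  show "V_equiv \<subseteq> V_space \<times> V_space" by (auto simp: V_equiv_def)
  show "refl_on V_space V_equiv" by (auto simp: refl_on_def V_equiv_def)
  show "sym V_equiv" unfolding sym_def V_equiv_def by clarsimp metis
  show "trans V_equiv"
  proof (rule transI)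
    fix x y z assume xy: "(x, y) \<in> V_equiv" and yz: "(y, z) \<in> V_equiv"
    from xy obtain a b where ab: "a \<ge> 1" "b \<ge> 1" "x \<otimes>\<^sub>v ones_vec a = y \<otimes>\<^sub>v ones_vec b"
      by (auto simp: V_equiv_def)
    from yz obtain c d where cd: "c \<ge> 1" "d \<ge> 1" "y \<otimes>\<^sub>v ones_vec c = z \<otimes>\<^sub>v ones_vec d"
      by (auto simp: V_equiv_def)
    have "x \<otimes>\<^sub>v ones_vec (a * c) = z \<otimes>\<^sub>v ones_vec (d * b)"
      by (metis ab(3) cd(3) kron_ones_kron_ones mult.commute)
    moreover have "a * c \<ge> 1" "d * b \<ge> 1" using ab cd by auto
    ultimately show "(x, z) \<in> V_equiv" using xy yz unfolding V_equiv_def by blast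
  qed
qed

lemma dim_V_add: "dim_vec (V_add x y) = lcm (dim_vec x) (dim_vec y)"
  by (simp add: V_add_def Let_def)

lemma V_add_closed: "x \<in> V_space \<Longrightarrow> y \<in> V_space \<Longrightarrow> V_add x y \<in> V_space"
  by (simp add: V_space_iff dim_V_add Suc_le_eq lcm_pos_nat)

lemma V_add_kron_ones:
  assumes x: "x \<in> V_space" and y: "y \<in> V_space"
    and s: "dim_vec x dvd s" "dim_vec y dvd s"
  shows "V_add x y \<otimes>\<^sub>v ones_vec (s div lcm (dim_vec x) (dim_vec y)) =
    x \<otimes>\<^sub>v ones_vec (s div dim_vec x) + y \<otimes>\<^sub>v ones_vec (s div dim_vec y)"
proof -
  define t where "t = lcm (dim_vec x) (dim_vec y)"
  have t: "dim_vec x dvd t" "dim_vec y dvd t" "t dvd s" using s by (auto simp: t_def)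
  have pos: "dim_vec x > 0" "dim_vec y > 0" using x y by (auto simp: V_space_iff)
  have dims: "dim_vec (x \<otimes>\<^sub>v ones_vec (t div dim_vec x)) = dim_vec (y \<otimes>\<^sub>v ones_vec (t div dim_vec y))"
    using t by simp
  have quot: "t div d * (s div t) = s div d" if "d dvd t" "d > 0" for d
  proof -
    from that t(3) obtain k l where "t = d * k" "s = d * k * l" by (auto elim!: dvdE)
    then show ?thesis using that by (cases "k = 0") simp_all
  qed
  have "V_add x y = x \<otimes>\<^sub>v ones_vec (t div dim_vec x) + y \<otimes>\<^sub>v ones_vec (t div dim_vec y)"
    unfolding V_add_def Let_def t_def ..
  then show ?thesis
    unfolding t_def[symmetric]
    by (simp only: kron_ones_add[OF dims] kron_ones_kron_ones quot[OF t(1) pos(1)] quot[OF t(2) pos(2)])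
qed

lemma V_add_respects: "(\<lambda>x y. V_class (V_add x y)) respects2 V_equiv"
proof (rule congruent2I')
  fix x x' y y' assume xx: "(x, x') \<in> V_equiv" and yy: "(y, y') \<in> V_equiv"
  then have V: "x \<in> V_space" "x' \<in> V_space" "y \<in> V_space" "y' \<in> V_space"
    by (auto simp: V_equiv_def)
  from xx obtain a a' where a: "a \<ge> 1" "a' \<ge> 1" "x \<otimes>\<^sub>v ones_vec a = x' \<otimes>\<^sub>v ones_vec a'"
    by (auto simp: V_equiv_def)
  from yy obtain b b' where b: "b \<ge> 1" "b' \<ge> 1" "y \<otimes>\<^sub>v ones_vec b = y' \<otimes>\<^sub>v ones_vec b'"
    by (auto simp: V_equiv_def)
  define m m' n n' where d: "m = dim_vec x" "m' = dim_vec x'" "n = dim_vec y" "n' = dim_vec y'"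
  have ma: "m * a = m' * a'" using arg_cong[OF a(3), of dim_vec] by (simp add: d)
  have nb: "n * b = n' * b'" using arg_cong[OF b(3), of dim_vec] by (simp add: d)
  have pos: "m > 0" "m' > 0" "n > 0" "n' > 0" using V by (auto simp: V_space_iff d)
  define s where "s = (m * a) * (n * b)"
  have s': "s = (m' * a') * (n' * b')" by (simp add: s_def ma nb)
  have s0: "s > 0" using pos a b by (simp add: s_def)
  have dv: "m dvd s" "n dvd s" by (simp_all add: s_def)
  have dv': "m' dvd s" "n' dvd s" by (simp_all add: s')
  have "s = m * (a * (n * b))" "s = m' * (a' * (n * b))"
    by (simp add: s_def) (simp add: s' nb)
  then have "s div m = a * (n * b)" "s div m' = a' * (n * b)"
    using pos by (metis nonzero_mult_div_cancel_left not_gr_zero)+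
  then have X: "x \<otimes>\<^sub>v ones_vec (s div m) = x' \<otimes>\<^sub>v ones_vec (s div m')"
    by (metis a(3) kron_ones_kron_ones)
  have "s = n * (b * (m * a))" "s = n' * (b' * (m * a))"
    by (simp add: s_def) (simp add: s' ma)
  then have "s div n = b * (m * a)" "s div n' = b' * (m * a)"
    using pos by (metis nonzero_mult_div_cancel_left not_gr_zero)+
  then have Y: "y \<otimes>\<^sub>v ones_vec (s div n) = y' \<otimes>\<^sub>v ones_vec (s div n')"
    by (metis b(3) kron_ones_kron_ones)
  have "V_add x y \<otimes>\<^sub>v ones_vec (s div lcm m n) = V_add x' y' \<otimes>\<^sub>v ones_vec (s div lcm m' n')"
    using V_add_kron_ones[of x y s] V_add_kron_ones[of x' y' s] V dv dv' X Y by (simp add: d)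
  moreover have "s div lcm m n \<ge> 1" "s div lcm m' n' \<ge> 1"
    using dv dv' s0 pos by (simp_all add: Suc_le_eq div_greater_zero_iff dvd_imp_le lcm_pos_nat)
  ultimately have "(V_add x y, V_add x' y') \<in> V_equiv"
    using V V_add_closed unfolding V_equiv_def by blast
  then show "V_class (V_add x y) = V_class (V_add x' y')"
    unfolding V_class_def by (rule equiv_class_eq[OF equiv_V_equiv])
qed

lemma V_smult_respects: "(\<lambda>x. V_class (a \<cdot>\<^sub>v x)) respects V_equiv"
proof (rule congruentI)
  fix x x' assume "(x, x') \<in> V_equiv"
  then have "(a \<cdot>\<^sub>v x, a \<cdot>\<^sub>v x') \<in> V_equiv"
    unfolding V_equiv_def by (auto simp: V_space_iff kron_ones_smult) metis
  then show "V_class (a \<cdot>\<^sub>v x) = V_class (a \<cdot>\<^sub>v x')"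
    unfolding V_class_def by (rule equiv_class_eq[OF equiv_V_equiv])
qed

lemma Omega_add_class:
  assumes "x \<in> V_space" "y \<in> V_space"
  shows "Omega_add (V_class x) (V_class y) = V_class (V_add x y)"
  using UN_equiv_class2[OF equiv_V_equiv equiv_V_equiv V_add_respects assms]
  by (simp add: Omega_add_def V_class_def)

lemma Omega_smult_class:
  assumes "x \<in> V_space"
  shows "Omega_smult a (V_class x) = V_class (a \<cdot>\<^sub>v x)"
  using UN_equiv_class[OF equiv_V_equiv V_smult_respects assms]
  by (simp add: Omega_smult_def V_class_def)

end

theory Submission
  imports Defs
begin

text \<open>
  Replacing \<open>x\<close> by \<open>x \<otimes>\<^sub>v ones_vec k\<close> does not change its class, so finitely many classes
  always have representatives of one common dimension, for instance the product of the
  dimensions of arbitrary representatives (\<open>Omega_common_rep2\<close>, \<open>Omega_common_rep3\<close>).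
  On vectors of equal dimension the V-addition is the ordinary sum
  (\<open>Omega_add_same_dim\<close>), and the zero vectors of all dimensions are equivalent
  (\<open>V_class_zero_vec\<close>). Each vector space axiom involves at most three classes, hence it is
  an instance of the same axiom in a single space \<open>\<real>\<^sup>n\<close>.
\<close>

lemma V_space_carrier_vec: "n > 0 \<Longrightarrow> x \<in> carrier_vec n \<Longrightarrow> x \<in> V_space"
  by (auto simp: V_space_iff)

lemma kron_ones_1: "x \<otimes>\<^sub>v ones_vec 1 = x"
  by (rule eq_vecI) (auto simp: index_kron_ones)

lemma V_class_kron_ones:
  assumes x: "x \<in> V_space" and k: "k > 0"
  shows "V_class (x \<otimes>\<^sub>v ones_vec k) = V_class x"
proof -
  have "x \<otimes>\<^sub>v ones_vec k \<otimes>\<^sub>v ones_vec 1 = x \<otimes>\<^sub>v ones_vec k"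
    by (rule kron_ones_1)
  moreover have "x \<otimes>\<^sub>v ones_vec k \<in> V_space"
    using x k by (simp add: V_space_iff)
  ultimately have "(x \<otimes>\<^sub>v ones_vec k, x) \<in> V_equiv"
    using x k unfolding V_equiv_def by (auto simp: Suc_le_eq)
  then show ?thesis
    unfolding V_class_def by (rule equiv_class_eq[OF equiv_V_equiv])
qed

lemma V_class_zero_vec:
  assumes "n > 0"
  shows "V_class (0\<^sub>v n) = V_class (0\<^sub>v 1)"
proof -
  have "0\<^sub>v 1 \<otimes>\<^sub>v ones_vec n = 0\<^sub>v n"
    by (rule eq_vecI) (auto simp: index_kron_ones)
  then show ?thesis
    using V_class_kron_ones[of "0\<^sub>v 1" n] assms by (simp add: V_space_iff)
qed

lemma V_add_same_dim:
  assumes "n > 0" "x \<in> carrier_vec n" "y \<in> carrier_vec n"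
  shows "V_add x y = x + y"
  using assms kron_ones_1 by (simp add: V_add_def)

lemma Omega_add_same_dim:
  assumes "n > 0" "x \<in> carrier_vec n" "y \<in> carrier_vec n"
  shows "Omega_add (V_class x) (V_class y) = V_class (x + y)"
  using assms by (simp add: Omega_add_class V_space_carrier_vec[of n] V_add_same_dim[of n])

lemma V_class_in_carrier: "x \<in> V_space \<Longrightarrow> V_class x \<in> carrier Omega"
  by (simp add: Omega_def V_class_def quotientI)

lemma Omega_rep:
  assumes "X \<in> carrier Omega"
  obtains x where "x \<in> V_space" "X = V_class x"
  using assms by (auto simp: Omega_def V_class_def elim!: quotientE)

text \<open>
  Each representative is stretched by the product of the other two dimensions, which brings
  all three to the product of the dimensions.
\<close>

lemma Omega_common_rep3:
  assumes "X \<in> carrier Omega" "Y \<in> carrier Omega" "Z \<in> carrier Omega"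
  obtains n x y z where "n > 0"
    "x \<in> carrier_vec n" "X = V_class x"
    "y \<in> carrier_vec n" "Y = V_class y"
    "z \<in> carrier_vec n" "Z = V_class z"
proof -
  obtain x where x: "x \<in> V_space" "X = V_class x" using Omega_rep[OF assms(1)] .
  obtain y where y: "y \<in> V_space" "Y = V_class y" using Omega_rep[OF assms(2)] .
  obtain z where z: "z \<in> V_space" "Z = V_class z" using Omega_rep[OF assms(3)] .
  let ?a = "dim_vec x" and ?b = "dim_vec y" and ?c = "dim_vec z"
  have pos: "?a > 0" "?b > 0" "?c > 0" using x y z by (auto simp: V_space_iff)
  show ?thesis
  proof (rule that)
    show "?a * ?b * ?c > 0" using pos by simp
    show "x \<otimes>\<^sub>v ones_vec (?b * ?c) \<in> carrier_vec (?a * ?b * ?c)"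
      "y \<otimes>\<^sub>v ones_vec (?a * ?c) \<in> carrier_vec (?a * ?b * ?c)"
      "z \<otimes>\<^sub>v ones_vec (?a * ?b) \<in> carrier_vec (?a * ?b * ?c)"
      by (rule carrier_vecI, simp)+
    show "X = V_class (x \<otimes>\<^sub>v ones_vec (?b * ?c))"
      "Y = V_class (y \<otimes>\<^sub>v ones_vec (?a * ?c))"
      "Z = V_class (z \<otimes>\<^sub>v ones_vec (?a * ?b))"
      unfolding x(2) y(2) z(2) using pos
      by (simp_all add: V_class_kron_ones[OF x(1)] V_class_kron_ones[OF y(1)] V_class_kron_ones[OF z(1)])
  qed
qed

lemma Omega_common_rep2:
  assumes "X \<in> carrier Omega" "Y \<in> carrier Omega"
  obtains n x y where "n > 0"
    "x \<in> carrier_vec n" "X = V_class x"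
    "y \<in> carrier_vec n" "Y = V_class y"
  by (rule Omega_common_rep3[OF assms assms(2)]) (rule that)

lemma Omega_simps:
  "\<zero>\<^bsub>Omega\<^esub> = V_class (0\<^sub>v 1)" "X \<oplus>\<^bsub>Omega\<^esub> Y = Omega_add X Y" "a \<odot>\<^bsub>Omega\<^esub> X = Omega_smult a X"
  by (simp_all add: Omega_def)

lemma abelian_group_Omega: "abelian_group Omega"
proof (rule abelian_groupI)
  show "\<zero>\<^bsub>Omega\<^esub> \<in> carrier Omega"
    by (simp add: Omega_simps V_class_in_carrier V_space_iff)
next
  fix X Y assume "X \<in> carrier Omega" "Y \<in> carrier Omega"
  then obtain n x y where *: "n > 0" "x \<in> carrier_vec n" "X = V_class x"
    "y \<in> carrier_vec n" "Y = V_class y" by (rule Omega_common_rep2)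
  then have "x + y \<in> V_space" by (intro V_space_carrier_vec[of n]) auto
  with * show "X \<oplus>\<^bsub>Omega\<^esub> Y \<in> carrier Omega"
    by (simp add: Omega_simps Omega_add_same_dim V_class_in_carrier)
  from * show "X \<oplus>\<^bsub>Omega\<^esub> Y = Y \<oplus>\<^bsub>Omega\<^esub> X"
    by (simp add: Omega_simps Omega_add_same_dim comm_add_vec)
next
  fix X Y Z assume "X \<in> carrier Omega" "Y \<in> carrier Omega" "Z \<in> carrier Omega"
  then obtain n x y z where *: "n > 0" "x \<in> carrier_vec n" "X = V_class x"
    "y \<in> carrier_vec n" "Y = V_class y" "z \<in> carrier_vec n" "Z = V_class z"
    by (rule Omega_common_rep3)
  then show "X \<oplus>\<^bsub>Omega\<^esub> Y \<oplus>\<^bsub>Omega\<^esub> Z = X \<oplus>\<^bsub>Omega\<^esub> (Y \<oplus>\<^bsub>Omega\<^esub> Z)"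
    by (simp add: Omega_simps Omega_add_same_dim[of n] assoc_add_vec[of _ n])
next
  fix X assume "X \<in> carrier Omega"
  then obtain x where x: "x \<in> V_space" "X = V_class x" by (rule Omega_rep)
  define n where "n = dim_vec x"
  have n: "n > 0" "x \<in> carrier_vec n" using x by (auto simp: n_def V_space_iff)
  have zero: "\<zero>\<^bsub>Omega\<^esub> = V_class (0\<^sub>v n)"
    unfolding Omega_simps by (rule V_class_zero_vec[OF n(1), symmetric])
  show "\<zero>\<^bsub>Omega\<^esub> \<oplus>\<^bsub>Omega\<^esub> X = X"
    using n x unfolding zero by (simp add: Omega_simps Omega_add_same_dim[of n])
  have "V_class (- x) \<oplus>\<^bsub>Omega\<^esub> X = \<zero>\<^bsub>Omega\<^esub>"
    using n x unfolding zero by (simp add: Omega_simps Omega_add_same_dim[of n])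
  moreover have "V_class (- x) \<in> carrier Omega"
    using n by (intro V_class_in_carrier V_space_carrier_vec[of n]) auto
  ultimately show "\<exists>Y\<in>carrier Omega. Y \<oplus>\<^bsub>Omega\<^esub> X = \<zero>\<^bsub>Omega\<^esub>" by blast
qed

theorem mainTheorem5:
  shows "vectorspace (class_ring :: real ring) Omega"
proof -
  have "module (class_ring :: real ring) Omega"
  proof (rule moduleI)
    show "cring (class_ring :: real ring)" ..
    show "abelian_group Omega" by (rule abelian_group_Omega)
  next
    fix a b X assume "X \<in> carrier Omega"
    then obtain x where x: "x \<in> V_space" "X = V_class x" by (rule Omega_rep)
    define n where "n = dim_vec x"
    have n: "n > 0" "x \<in> carrier_vec n" using x by (auto simp: n_def V_space_iff)
    have V: "c \<cdot>\<^sub>v x \<in> V_space" for c using x by (simp add: V_space_iff)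
    show "a \<odot>\<^bsub>Omega\<^esub> X \<in> carrier Omega"
      using x V by (simp add: Omega_simps Omega_smult_class V_class_in_carrier)
    show "(a \<oplus>\<^bsub>class_ring\<^esub> b) \<odot>\<^bsub>Omega\<^esub> X = a \<odot>\<^bsub>Omega\<^esub> X \<oplus>\<^bsub>Omega\<^esub> b \<odot>\<^bsub>Omega\<^esub> X"
      using n x
      by (simp add: class_ring_simps Omega_simps Omega_smult_class Omega_add_same_dim[of n]
          add_smult_distrib_vec)
    show "(a \<otimes>\<^bsub>class_ring\<^esub> b) \<odot>\<^bsub>Omega\<^esub> X = a \<odot>\<^bsub>Omega\<^esub> (b \<odot>\<^bsub>Omega\<^esub> X)"
      using x V by (simp add: class_ring_simps Omega_simps Omega_smult_class smult_smult_assoc)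
    show "\<one>\<^bsub>class_ring\<^esub> \<odot>\<^bsub>Omega\<^esub> X = X"
      using x by (simp add: class_ring_simps Omega_simps Omega_smult_class)
  next
    fix a X Y assume "X \<in> carrier Omega" "Y \<in> carrier Omega"
    then obtain n x y where *: "n > 0" "x \<in> carrier_vec n" "X = V_class x"
      "y \<in> carrier_vec n" "Y = V_class y" by (rule Omega_common_rep2)
    then have V: "x \<in> V_space" "y \<in> V_space" "x + y \<in> V_space"
      by (auto intro: V_space_carrier_vec[of n])
    show "a \<odot>\<^bsub>Omega\<^esub> (X \<oplus>\<^bsub>Omega\<^esub> Y) = a \<odot>\<^bsub>Omega\<^esub> X \<oplus>\<^bsub>Omega\<^esub> a \<odot>\<^bsub>Omega\<^esub> Y"
      using * V
      by (simp add: Omega_simps Omega_smult_class Omega_add_same_dim[of n] smult_add_distrib_vec)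
  qed
  then show ?thesis
    by (rule vectorspace.intro) (rule class_field.field_axioms)
qed

end
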